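(* Let $n\in\mathbb N$ with $n\ge 16$. Put $k:=\lfloor \log_2 n\rfloor-4$, $m:=\lfloor n2^{-k}\rfloor+1$ and $\tilde n:=m2^k$. Then $$n+1\le \tilde n .$$ Moreover, if $n=2^p\ell-1$ for some integer $p\ge 0$ and some $\ell\in\{16,\ldots,31\}$, then $\tilde n=n+1$.
   Context: $\lfloor x\rfloor$ denotes the largest integer not greater than $x$. The number $\tilde n$ is the order to which an $(n\times n)$ matrix is padded with zero rows and columns so that Strassen's recursive matrix multiplication algorithm (which applies to matrices of order $m2^k$) can be used, with Strassen's choice of $m$ and $k$. *)

theory Defs
  imports Complex_Main
begin

text \<open>
  Strassen's choice of parameters: an \<open>n \<times> n\<close> matrix is padded to order \<open>m 2^k\<close>.
  The conversion \<open>nat\<close> in \<open>strassen_k\<close> truncates only for \<open>n < 16\<close>, where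
  \<open>\<lfloor>log 2 n\<rfloor> - 4\<close> is negative; the parameters are meant for \<open>n \<ge> 16\<close>.
  In \<open>strassen_m\<close> the argument of \<open>nat\<close> is never negative.
\<close>

definition strassen_k :: "nat \<Rightarrow> nat" where
  "strassen_k n = nat (\<lfloor>log 2 (real n)\<rfloor> - 4)"

definition strassen_m :: "nat \<Rightarrow> nat" where
  "strassen_m n = nat \<lfloor>real n * 2 powi (- int (strassen_k n))\<rfloor> + 1"

definition padded_order :: "nat \<Rightarrow> nat" where
  "padded_order n = strassen_m n * 2 ^ strassen_k n"

end

theory Submission
  imports Defs
begin

text \<open>
  Since \<open>m = \<lfloor>n / 2^k\<rfloor> + 1\<close>, the padded order \<open>m 2^k\<close> is the least multiple of \<open>2^k\<close> that
  exceeds \<open>n\<close>.  This gives the lower bound \<open>n + 1\<close> for every \<open>k\<close>, and shows that the bound is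
  attained as soon as \<open>2^k\<close> divides \<open>n + 1\<close>.  If \<open>n + 1 = 2^p l\<close> with \<open>l < 32\<close>, then
  \<open>n < 2^(p + 5)\<close> and hence \<open>k \<le> p\<close>, so that \<open>2^k\<close> does divide \<open>n + 1\<close>.
  Equality \<open>k = p\<close> fails for \<open>l = 16\<close>, where \<open>n = 2^(p + 4) - 1\<close> leads to \<open>k = p - 1\<close>.
\<close>

lemma padded_order_div:
  "padded_order n = (n div 2 ^ strassen_k n + 1) * 2 ^ strassen_k n"
proof -
  have "real n * 2 powi (- int (strassen_k n)) = real n / real (2 ^ strassen_k n)"
    by (simp add: power_int_minus field_simps)
  then have "\<lfloor>real n * 2 powi (- int (strassen_k n))\<rfloor> = int (n div 2 ^ strassen_k n)"
    by (simp only: floor_divide_of_nat_eq)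
  then show ?thesis
    by (simp add: padded_order_def strassen_m_def)
qed

lemma less_padded_order: "n < padded_order n"
proof -
  have "n < 2 ^ strassen_k n + (n div 2 ^ strassen_k n) * 2 ^ strassen_k n"
    by (rule dividend_less_div_times) simp
  then show ?thesis
    by (simp add: padded_order_div)
qed

lemma padded_order_eq_Suc:
  assumes "2 ^ strassen_k n dvd n + 1"
  shows "padded_order n = n + 1"
proof -
  let ?d = "2 ^ strassen_k n :: nat"
  obtain c where c: "n + 1 = ?d * c"
    using assms by (rule dvdE)
  have "?d * (n div ?d) < ?d * c"
    using c times_div_less_eq_dividend[of ?d n] by linarith
  then have "n div ?d + 1 \<le> c"
    by simp
  then have "padded_order n \<le> n + 1"
    unfolding padded_order_div c by (subst mult.commute) (rule mult_le_mono2)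
  with less_padded_order[of n] show ?thesis
    by simp
qed

lemma strassen_k_le:
  assumes "0 < n" and "n < 2 ^ (p + 5)"
  shows "strassen_k n \<le> p"
proof -
  have "real n < 2 ^ (p + 5)"
    using assms(2) by (metis of_nat_less_iff of_nat_numeral of_nat_power)
  then have "log 2 (real n) < real (p + 5)"
    using assms(1) by (simp only: log_of_power_less of_nat_0_less_iff)
  then have "\<lfloor>log 2 (real n)\<rfloor> < int p + 5"
    by (simp add: floor_less_iff)
  then show ?thesis
    by (simp add: strassen_k_def)
qed

theorem theorem2p2:
  fixes n :: nat
  assumes "n \<ge> 16"
  shows "n + 1 \<le> padded_order n \<and>
    ((\<exists>p l :: nat. l \<in> {16..31} \<and> int n = 2 ^ p * int l - 1) \<longrightarrow> padded_order n = n + 1)"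
proof (intro conjI impI)
  show "n + 1 \<le> padded_order n"
    using less_padded_order[of n] by simp
next
  assume "\<exists>p l :: nat. l \<in> {16..31} \<and> int n = 2 ^ p * int l - 1"
  then obtain p l :: nat where l: "l \<le> 31" and "int n = 2 ^ p * int l - 1"
    by auto
  then have "int (n + 1) = int (2 ^ p * l)"
    by simp
  then have n: "n + 1 = 2 ^ p * l"
    by (simp only: of_nat_eq_iff)
  have "n + 1 \<le> 2 ^ p * 32"
    unfolding n using l by (intro mult_le_mono2) simp
  then have "n < 2 ^ (p + 5)"
    by (simp add: power_add)
  with assms have "strassen_k n \<le> p"
    by (intro strassen_k_le) simp_all
  then have "2 ^ strassen_k n dvd n + 1"
    unfolding n by (intro dvd_mult2 le_imp_power_dvd)
  then show "padded_order n = n + 1"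
    by (rule padded_order_eq_Suc)
qed

end
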